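(* Let $\langle U,\theta\rangle$ be an approximation space with $|\theta_u|>1$ for all $u\in U$. Then its principal rough set algebra $R_\theta$ is embedded into $C_3^U$ as a core regular double Stone algebra via the composite $$\alpha_r\circ\phi: R_\theta\hookrightarrow TP_U\hookrightarrow C_3^U,$$ where $\phi(\langle\underline{X},\overline{X}\rangle)=(\underline{X},\overline{X}^c)$ and $\alpha_r$ is the restriction to the image of $\phi$ of the map $\alpha:TP_U\to C_3^U$ defined by $\alpha(X_1,X_2)=(x_i)_{i\in U}$ with $x_i=1$ if $i\in X_1$, $x_i=h$ if $i\in(X_1\cup X_2)^c$, and $x_i=0$ if $i\in X_2$. That is, $\phi$ and $\alpha_r\circ\phi$ are injective homomorphisms of core regular double Stone algebras, and hence $R_\theta$ can be identified with its images in $TP_U$ and $C_3^U$.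
   Context: An approximation space $\langle U,\theta\rangle$ is a nonempty set $U$ with an equivalence relation $\theta$; $\theta_x$ denotes the $\theta$-class of $x$. For $X\subseteq U$, $\overline{X}=\bigcup\{\theta_x:\theta_x\cap X\neq\emptyset\}$ and $\underline{X}=\bigcup\{\theta_x:\theta_x\subseteq X\}$; the pair $\langle\underline{X},\overline{X}\rangle$ is a rough set. $R_\theta$ is the set of all rough sets $\langle\underline{X},\overline{X}\rangle$, $X\subseteq U$. Complements $^c$ are in $U$. The principal rough set algebra, also denoted $R_\theta$, has $0=\langle\emptyset,\emptyset\rangle$, $1=\langle U,U\rangle$, componentwise union as $\vee$, componentwise intersection as $\wedge$, $\langle\underline{X},\overline{X}\rangle^*=\langle\overline{X}^c,\overline{X}^c\rangle$ and $\langle\underline{X},\overline{X}\rangle^+=\langle\underline{X}^c,\underline{X}^c\rangle$. A double Stone algebra $\langle L,\wedge,\vee,*,+,0,1\rangle$ is a bounded distributive lattice with unary operations such that $y\le x^*\iff y\wedge x=0$, $y\ge x^+\iff y\vee x=1$, $x^*\vee x^{**}=1$ and $x^+\wedge x^{++}=0$. It is regular if $x\wedge x^+\le y\vee y^*$ for all $x,y$. An element $x$ is dense if $x^*=0$ and dually dense if $x^+=1$; the core is the set of elements that are both. A core regular double Stone algebra (CRDSA) is a regular double Stone algebra with nonempty core; the core then has a unique element $h$, treated as a constant, so a CRDSA is an algebra $\langle L,\wedge,\vee,*,+,0,1,h\rangle$, and CRDSA homomorphisms preserve all these operations and constants. $C_3=\{0<h<1\}$ is the 3-element chain with $0^*=1,\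 h^*=0,\ 1^*=0$ and $0^+=1,\ h^+=1,\ 1^+=0$; $C_3^U$ carries pointwise operations. $TP_U=\{(X_1,X_2):X_1,X_2\subseteq U,\ X_1\cap X_2=\emptyset\}$ with $(X_1,X_2)\vee(Y_1,Y_2)=(X_1\cup Y_1,X_2\cap Y_2)$, $(X_1,X_2)\wedge(Y_1,Y_2)=(X_1\cap Y_1,X_2\cup Y_2)$, $0=(\emptyset,U)$, $1=(U,\emptyset)$, $h=(\emptyset,\emptyset)$, $(X_1,X_2)^*=(X_2,X_2^c)$, $(X_1,X_2)^+=(X_1^c,X_1)$. *)

theory Defs
  imports "HOL-Algebra.Congruence"
begin

text \<open>\<open>pcompl\<close> is the pseudocomplement \<open>x\<^sup>*\<close> and \<open>dpcompl\<close> its dual \<open>x\<^sup>+\<close>.\<close>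

record 'a dsa_sig = "'a partial_object" +
  meet :: "'a \<Rightarrow> 'a \<Rightarrow> 'a" (infixl "\<sqinter>\<index>" 70)
  join :: "'a \<Rightarrow> 'a \<Rightarrow> 'a" (infixl "\<squnion>\<index>" 65)
  pcompl :: "'a \<Rightarrow> 'a"
  dpcompl :: "'a \<Rightarrow> 'a"
  lzero :: 'a ("\<zero>\<index>")
  lone :: 'a ("\<one>\<index>")

record 'a crdsa_sig = "'a dsa_sig" +
  core_elt :: 'a

definition lat_le :: "('a, 'm) dsa_sig_scheme \<Rightarrow> 'a \<Rightarrow> 'a \<Rightarrow> bool" (infix "\<sqsubseteq>\<index>" 50)
  where "x \<sqsubseteq>\<^bsub>L\<^esub> y \<longleftrightarrow> x \<sqinter>\<^bsub>L\<^esub> y = x"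

locale double_stone_algebra =
  fixes L :: "('a, 'm) dsa_sig_scheme" (structure)
  assumes meet_closed: "\<lbrakk>x \<in> carrier L; y \<in> carrier L\<rbrakk> \<Longrightarrow> x \<sqinter> y \<in> carrier L"
    and join_closed: "\<lbrakk>x \<in> carrier L; y \<in> carrier L\<rbrakk> \<Longrightarrow> x \<squnion> y \<in> carrier L"
    and pcompl_closed: "x \<in> carrier L \<Longrightarrow> pcompl L x \<in> carrier L"
    and dpcompl_closed: "x \<in> carrier L \<Longrightarrow> dpcompl L x \<in> carrier L"
    and zero_closed: "\<zero> \<in> carrier L"
    and one_closed: "\<one> \<in> carrier L"
    and meet_assoc: "\<lbrakk>x \<in> carrier L; y \<in> carrier L; z \<in> carrier L\<rbrakk>
          \<Longrightarrow> (x \<sqinter> y) \<sqinter> z = x \<sqinter> (y \<sqinter> z)"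
    and join_assoc: "\<lbrakk>x \<in> carrier L; y \<in> carrier L; z \<in> carrier L\<rbrakk>
          \<Longrightarrow> (x \<squnion> y) \<squnion> z = x \<squnion> (y \<squnion> z)"
    and meet_comm: "\<lbrakk>x \<in> carrier L; y \<in> carrier L\<rbrakk> \<Longrightarrow> x \<sqinter> y = y \<sqinter> x"
    and join_comm: "\<lbrakk>x \<in> carrier L; y \<in> carrier L\<rbrakk> \<Longrightarrow> x \<squnion> y = y \<squnion> x"
    and meet_absorb: "\<lbrakk>x \<in> carrier L; y \<in> carrier L\<rbrakk> \<Longrightarrow> x \<sqinter> (x \<squnion> y) = x"
    and join_absorb: "\<lbrakk>x \<in> carrier L; y \<in> carrier L\<rbrakk> \<Longrightarrow> x \<squnion> (x \<sqinter> y) = x"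
    and distrib: "\<lbrakk>x \<in> carrier L; y \<in> carrier L; z \<in> carrier L\<rbrakk>
          \<Longrightarrow> x \<sqinter> (y \<squnion> z) = (x \<sqinter> y) \<squnion> (x \<sqinter> z)"
    and zero_le: "x \<in> carrier L \<Longrightarrow> \<zero> \<sqsubseteq> x"
    and le_one: "x \<in> carrier L \<Longrightarrow> x \<sqsubseteq> \<one>"
    and le_pcompl_iff: "\<lbrakk>x \<in> carrier L; y \<in> carrier L\<rbrakk>
          \<Longrightarrow> y \<sqsubseteq> pcompl L x \<longleftrightarrow> y \<sqinter> x = \<zero>"
    and dpcompl_le_iff: "\<lbrakk>x \<in> carrier L; y \<in> carrier L\<rbrakk>
          \<Longrightarrow> dpcompl L x \<sqsubseteq> y \<longleftrightarrow> y \<squnion> x = \<one>"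
    and stone: "x \<in> carrier L \<Longrightarrow> pcompl L x \<squnion> pcompl L (pcompl L x) = \<one>"
    and dual_stone: "x \<in> carrier L \<Longrightarrow> dpcompl L x \<sqinter> dpcompl L (dpcompl L x) = \<zero>"

locale regular_double_stone_algebra = double_stone_algebra +
  assumes regular: "\<lbrakk>x \<in> carrier L; y \<in> carrier L\<rbrakk>
          \<Longrightarrow> x \<sqinter> dpcompl L x \<sqsubseteq> y \<squnion> pcompl L y"

definition dense :: "('a, 'm) dsa_sig_scheme \<Rightarrow> 'a \<Rightarrow> bool"
  where "dense L x \<longleftrightarrow> pcompl L x = \<zero>\<^bsub>L\<^esub>"

definition dually_dense :: "('a, 'm) dsa_sig_scheme \<Rightarrow> 'a \<Rightarrow> bool"
  where "dually_dense L x \<longleftrightarrow> dpcompl L x = \<one>\<^bsub>L\<^esub>"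

definition core :: "('a, 'm) dsa_sig_scheme \<Rightarrow> 'a set"
  where "core L = {x \<in> carrier L. dense L x \<and> dually_dense L x}"

text \<open>In a regular double Stone algebra the core has at most one element, so the axiom below
  both makes the core nonempty and determines the constant.\<close>

locale crdsa = regular_double_stone_algebra L
  for L :: "('a, 'm) crdsa_sig_scheme" (structure) +
  assumes core_elt_in_core: "core_elt L \<in> core L"

text \<open>The description operator is meaningful only when the core is a singleton; for rough set
  algebras that is the case as soon as every class has more than one element.\<close>

definition with_core_elt :: "'a dsa_sig \<Rightarrow> 'a crdsa_sig"
  where "with_core_elt L = dsa_sig.extend L (crdsa_sig.fields (THE x. x \<in> core L))"

definition crdsa_hom :: "('a, 'm) crdsa_sig_scheme \<Rightarrow> ('b, 'n) crdsa_sig_scheme \<Rightarrow> ('a \<Rightarrow> 'b) set"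
  where "crdsa_hom A B =
    {f. f \<in> carrier A \<rightarrow> carrier B \<and>
        (\<forall>x\<in>carrier A. \<forall>y\<in>carrier A. f (x \<sqinter>\<^bsub>A\<^esub> y) = f x \<sqinter>\<^bsub>B\<^esub> f y) \<and>
        (\<forall>x\<in>carrier A. \<forall>y\<in>carrier A. f (x \<squnion>\<^bsub>A\<^esub> y) = f x \<squnion>\<^bsub>B\<^esub> f y) \<and>
        (\<forall>x\<in>carrier A. f (pcompl A x) = pcompl B (f x)) \<and>
        (\<forall>x\<in>carrier A. f (dpcompl A x) = dpcompl B (f x)) \<and>
        f \<zero>\<^bsub>A\<^esub> = \<zero>\<^bsub>B\<^esub> \<and> f \<one>\<^bsub>A\<^esub> = \<one>\<^bsub>B\<^esub> \<and> f (core_elt A) = core_elt B}"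

definition crdsa_mon :: "('a, 'm) crdsa_sig_scheme \<Rightarrow> ('b, 'n) crdsa_sig_scheme \<Rightarrow> ('a \<Rightarrow> 'b) set"
  where "crdsa_mon A B = {f \<in> crdsa_hom A B. inj_on f (carrier A)}"

definition crdsa_iso :: "('a, 'm) crdsa_sig_scheme \<Rightarrow> ('b, 'n) crdsa_sig_scheme \<Rightarrow> ('a \<Rightarrow> 'b) set"
  where "crdsa_iso A B = {f \<in> crdsa_hom A B. bij_betw f (carrier A) (carrier B)}"

locale approximation_space =
  fixes U :: "'a set" and \<theta> :: "('a \<times> 'a) set"
  assumes nonempty: "U \<noteq> {}"
    and equiv: "equiv U \<theta>"

definition upper :: "'a set \<Rightarrow> ('a \<times> 'a) set \<Rightarrow> 'a set \<Rightarrow> 'a set"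
  where "upper U \<theta> X = \<Union>{\<theta> `` {x} | x. x \<in> U \<and> \<theta> `` {x} \<inter> X \<noteq> {}}"

definition lower :: "'a set \<Rightarrow> ('a \<times> 'a) set \<Rightarrow> 'a set \<Rightarrow> 'a set"
  where "lower U \<theta> X = \<Union>{\<theta> `` {x} | x. x \<in> U \<and> \<theta> `` {x} \<subseteq> X}"

definition rough_sets :: "'a set \<Rightarrow> ('a \<times> 'a) set \<Rightarrow> ('a set \<times> 'a set) set"
  where "rough_sets U \<theta> = {(lower U \<theta> X, upper U \<theta> X) | X. X \<subseteq> U}"

definition rough_dsa :: "'a set \<Rightarrow> ('a \<times> 'a) set \<Rightarrow> ('a set \<times> 'a set) dsa_sig"
  where "rough_dsa U \<theta> =
    \<lparr>carrier = rough_sets U \<theta>,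
     meet = \<lambda>(A, B) (C, D). (A \<inter> C, B \<inter> D),
     join = \<lambda>(A, B) (C, D). (A \<union> C, B \<union> D),
     pcompl = \<lambda>(A, B). (U - B, U - B),
     dpcompl = \<lambda>(A, B). (U - A, U - A),
     lzero = ({}, {}),
     lone = (U, U)\<rparr>"

definition rough_algebra :: "'a set \<Rightarrow> ('a \<times> 'a) set \<Rightarrow> ('a set \<times> 'a set) crdsa_sig"
  where "rough_algebra U \<theta> = with_core_elt (rough_dsa U \<theta>)"

definition TP :: "'a set \<Rightarrow> ('a set \<times> 'a set) crdsa_sig"
  where "TP U =
    \<lparr>carrier = {(X1, X2). X1 \<subseteq> U \<and> X2 \<subseteq> U \<and> X1 \<inter> X2 = {}},
     meet = \<lambda>(X1, X2) (Y1, Y2). (X1 \<inter> Y1, X2 \<union> Y2),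
     join = \<lambda>(X1, X2) (Y1, Y2). (X1 \<union> Y1, X2 \<inter> Y2),
     pcompl = \<lambda>(X1, X2). (X2, U - X2),
     dpcompl = \<lambda>(X1, X2). (U - X1, X1),
     lzero = ({}, U),
     lone = (U, {}),
     core_elt = ({}, {})\<rparr>"

datatype three = Zero3 | H3 | One3

instantiation three :: linorder
begin

fun less_eq_three :: "three \<Rightarrow> three \<Rightarrow> bool" where
  "Zero3 \<le> _ \<longleftrightarrow> True"
| "H3 \<le> y \<longleftrightarrow> y \<noteq> Zero3"
| "One3 \<le> y \<longleftrightarrow> y = One3"

definition less_three :: "three \<Rightarrow> three \<Rightarrow> bool" where
  "x < y \<longleftrightarrow> x \<le> y \<and> x \<noteq> (y :: three)"

instance
proof
  fix x y z :: three
  show "x < y \<longleftrightarrow> x \<le> y \<and> \<not> y \<le> x"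
    by (cases x; cases y) (simp_all add: less_three_def)
  show "x \<le> x"
    by (cases x) simp_all
  show "x \<le> z" if "x \<le> y" "y \<le> z"
    using that by (cases x; cases y; cases z) simp_all
  show "x = y" if "x \<le> y" "y \<le> x"
    using that by (cases x; cases y) simp_all
  show "x \<le> y \<or> y \<le> x"
    by (cases x; cases y) simp_all
qed

end

definition C3 :: "three crdsa_sig"
  where "C3 =
    \<lparr>carrier = UNIV,
     meet = min,
     join = max,
     pcompl = (\<lambda>x. case x of Zero3 \<Rightarrow> One3 | H3 \<Rightarrow> Zero3 | One3 \<Rightarrow> Zero3),
     dpcompl = (\<lambda>x. case x of Zero3 \<Rightarrow> One3 | H3 \<Rightarrow> One3 | One3 \<Rightarrow> Zero3),
     lzero = Zero3,
     lone = One3,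
     core_elt = H3\<rparr>"

definition power_algebra :: "'b crdsa_sig \<Rightarrow> 'i set \<Rightarrow> ('i \<Rightarrow> 'b) crdsa_sig"
  where "power_algebra L I =
    \<lparr>carrier = I \<rightarrow>\<^sub>E carrier L,
     meet = \<lambda>f g. \<lambda>i\<in>I. f i \<sqinter>\<^bsub>L\<^esub> g i,
     join = \<lambda>f g. \<lambda>i\<in>I. f i \<squnion>\<^bsub>L\<^esub> g i,
     pcompl = \<lambda>f. \<lambda>i\<in>I. pcompl L (f i),
     dpcompl = \<lambda>f. \<lambda>i\<in>I. dpcompl L (f i),
     lzero = \<lambda>i\<in>I. \<zero>\<^bsub>L\<^esub>,
     lone = \<lambda>i\<in>I. \<one>\<^bsub>L\<^esub>,
     core_elt = \<lambda>i\<in>I. core_elt L\<rparr>"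

definition phi :: "'a set \<Rightarrow> 'a set \<times> 'a set \<Rightarrow> 'a set \<times> 'a set"
  where "phi U = (\<lambda>(A, B). (A, U - B))"

definition alpha :: "'a set \<Rightarrow> 'a set \<times> 'a set \<Rightarrow> 'a \<Rightarrow> three"
  where "alpha U = (\<lambda>(X1, X2). \<lambda>i\<in>U. if i \<in> X1 then One3 else if i \<in> X2 then Zero3 else H3)"

definition alpha_r :: "'a set \<Rightarrow> ('a \<times> 'a) set \<Rightarrow> 'a set \<times> 'a set \<Rightarrow> 'a \<Rightarrow> three"
  where "alpha_r U \<theta> = restrict (alpha U) (phi U ` carrier (rough_algebra U \<theta>))"

end

theory Submission
  imports Defs
begin

text \<open>When no class is a singleton, the rough sets are exactly the pairs \<open>A \<subseteq> B\<close> of unions of classes: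
  \<open>A\<close> together with one point from each class inside \<open>B\<close> has lower approximation \<open>A\<close> and upper
  approximation \<open>B\<close>. Everything else is transported: the axioms hold in the chain \<open>C3\<close>, hence
  pointwise in its powers, and they are reflected by injective homomorphisms.\<close>

section \<open>Transport of the axioms along injective homomorphisms\<close>

text \<open>These are the conditions that do not pass back along a homomorphism, so they are kept
  apart from the other axioms.\<close>

definition closed_sig :: "('a, 'm) crdsa_sig_scheme \<Rightarrow> bool"
  where "closed_sig L \<longleftrightarrow>
    (\<forall>x\<in>carrier L. \<forall>y\<in>carrier L. x \<sqinter>\<^bsub>L\<^esub> y \<in> carrier L \<and> x \<squnion>\<^bsub>L\<^esub> y \<in> carrier L) \<and>
    (\<forall>x\<in>carrier L. pcompl L x \<in> carrier L \<and> dpcompl L x \<in> carrier L) \<and>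
    \<zero>\<^bsub>L\<^esub> \<in> carrier L \<and> \<one>\<^bsub>L\<^esub> \<in> carrier L \<and> core_elt L \<in> carrier L"

lemma crdsa_closed_sig:
  assumes "crdsa L"
  shows "closed_sig L"
proof -
  interpret crdsa L by fact
  show ?thesis
    using core_elt_in_core
    by (simp add: closed_sig_def core_def meet_closed join_closed pcompl_closed dpcompl_closed
        zero_closed one_closed)
qed

text \<open>Apart from closure, each axiom is an equation or an order statement, or an equivalence
  of these. The order is itself defined by an equation, and injectivity makes every equation in
  \<open>A\<close> equivalent to its image in \<open>B\<close>.\<close>

lemma crdsa_reflect:
  fixes A :: "('a, 'm) crdsa_sig_scheme" and B :: "('b, 'n) crdsa_sig_scheme"
  assumes cl: "closed_sig A" and B: "crdsa B" and f: "f \<in> crdsa_mon A B"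
  shows "crdsa A"
proof -
  interpret B: crdsa B by (rule B)
  have c [simp]: "x \<sqinter>\<^bsub>A\<^esub> y \<in> carrier A" "x \<squnion>\<^bsub>A\<^esub> y \<in> carrier A"
    if "x \<in> carrier A" "y \<in> carrier A" for x y
    using cl that by (auto simp: closed_sig_def)
  have c1 [simp]: "pcompl A x \<in> carrier A" "dpcompl A x \<in> carrier A" if "x \<in> carrier A" for x
    using cl that by (auto simp: closed_sig_def)
  have c0 [simp]: "\<zero>\<^bsub>A\<^esub> \<in> carrier A" "\<one>\<^bsub>A\<^esub> \<in> carrier A" "core_elt A \<in> carrier A"
    using cl by (auto simp: closed_sig_def)
  have m [simp]: "f (x \<sqinter>\<^bsub>A\<^esub> y) = f x \<sqinter>\<^bsub>B\<^esub> f y" "f (x \<squnion>\<^bsub>A\<^esub> y) = f x \<squnion>\<^bsub>B\<^esub> f y"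
    if "x \<in> carrier A" "y \<in> carrier A" for x y
    using f that by (auto simp: crdsa_mon_def crdsa_hom_def)
  have m1 [simp]: "f x \<in> carrier B" "f (pcompl A x) = pcompl B (f x)"
      "f (dpcompl A x) = dpcompl B (f x)" if "x \<in> carrier A" for x
    using f that by (auto simp: crdsa_mon_def crdsa_hom_def)
  have m0 [simp]: "f \<zero>\<^bsub>A\<^esub> = \<zero>\<^bsub>B\<^esub>" "f \<one>\<^bsub>A\<^esub> = \<one>\<^bsub>B\<^esub>" "f (core_elt A) = core_elt B"
    using f by (auto simp: crdsa_mon_def crdsa_hom_def)
  have eq: "x = y \<longleftrightarrow> f x = f y" if "x \<in> carrier A" "y \<in> carrier A" for x y
    using f that by (auto simp: crdsa_mon_def inj_on_def)
  have le: "x \<sqsubseteq>\<^bsub>A\<^esub> y \<longleftrightarrow> f x \<sqsubseteq>\<^bsub>B\<^esub> f y" if "x \<in> carrier A" "y \<in> carrier A" for x y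
    using that by (simp add: lat_le_def eq)
  note [simp] = B.meet_closed B.join_closed B.pcompl_closed B.dpcompl_closed B.zero_closed B.one_closed
  have core: "pcompl B (core_elt B) = \<zero>\<^bsub>B\<^esub>" "dpcompl B (core_elt B) = \<one>\<^bsub>B\<^esub>"
    using B.core_elt_in_core by (auto simp: core_def dense_def dually_dense_def)
  show ?thesis
  \<comment> \<open>The goals follow the order of the locale axioms: 1 to 6 are closure, left to the
    final \<open>simp_all\<close>, and 21 is the core condition.\<close>
  proof (unfold_locales, goal_cases)
    case 7 then show ?case by (simp add: eq B.meet_assoc)
  next
    case 8 then show ?case by (simp add: eq B.join_assoc)
  next
    case 9 then show ?case by (simp add: eq B.meet_comm)
  next
    case 10 then show ?case by (simp add: eq B.join_comm)
  next
    case 11 then show ?case by (simp add: eq B.meet_absorb)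
  next
    case 12 then show ?case by (simp add: eq B.join_absorb)
  next
    case 13 then show ?case by (simp add: eq B.distrib)
  next
    case 14 then show ?case by (simp add: le B.zero_le)
  next
    case 15 then show ?case by (simp add: le B.le_one)
  next
    case 16 then show ?case by (simp add: eq le B.le_pcompl_iff)
  next
    case 17 then show ?case by (simp add: eq le B.dpcompl_le_iff)
  next
    case 18 then show ?case by (simp add: eq B.stone)
  next
    case 19 then show ?case by (simp add: eq B.dual_stone)
  next
    case 20 then show ?case by (simp add: le B.regular)
  next
    case 21 show ?case by (simp add: core_def dense_def dually_dense_def eq core)
  qed simp_all
qed

lemma crdsa_mon_comp:
  "f \<in> crdsa_mon A B \<Longrightarrow> g \<in> crdsa_mon B D \<Longrightarrow> g \<circ> f \<in> crdsa_mon A D"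
  by (auto simp: crdsa_mon_def crdsa_hom_def Pi_iff inj_on_def)

text \<open>The image carries the operations of \<open>B\<close>, so \<open>id\<close> embeds it
  into \<open>B\<close> and reflection applies once it is closed; \<open>f\<close> is onto it by
  construction.\<close>

lemma crdsa_image:
  fixes B :: "('b, 'n) crdsa_sig_scheme"
  assumes "crdsa A" "crdsa B" and f: "f \<in> crdsa_mon A B"
  shows "crdsa (B\<lparr>carrier := f ` carrier A\<rparr>)"
    and "f \<in> crdsa_iso A (B\<lparr>carrier := f ` carrier A\<rparr>)"
proof -
  have cl: "closed_sig A" using assms(1) by (rule crdsa_closed_sig)
  have hom: "f \<in> crdsa_hom A B" using f by (simp add: crdsa_mon_def)
  have img: "f x \<sqinter>\<^bsub>B\<^esub> f y = f (x \<sqinter>\<^bsub>A\<^esub> y)" "f x \<squnion>\<^bsub>B\<^esub> f y = f (x \<squnion>\<^bsub>A\<^esub> y)"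
      "pcompl B (f x) = f (pcompl A x)" "dpcompl B (f x) = f (dpcompl A x)"
      "\<zero>\<^bsub>B\<^esub> = f \<zero>\<^bsub>A\<^esub>" "\<one>\<^bsub>B\<^esub> = f \<one>\<^bsub>A\<^esub>" "core_elt B = f (core_elt A)"
    if "x \<in> carrier A" "y \<in> carrier A" for x y
    using hom that by (simp_all add: crdsa_hom_def)
  \<comment> \<open>The clauses of \<open>img\<close> for the constants also carry the premises on
    \<open>x\<close> and \<open>y\<close>, so some member of \<open>carrier A\<close> has to be
    supplied.\<close>
  have "\<zero>\<^bsub>A\<^esub> \<in> carrier A" using cl by (simp add: closed_sig_def)
  then have "closed_sig (B\<lparr>carrier := f ` carrier A\<rparr>)"
    using cl by (simp add: closed_sig_def img)
  moreover have "id \<in> crdsa_mon (B\<lparr>carrier := f ` carrier A\<rparr>) B"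
    using hom by (auto simp: crdsa_mon_def crdsa_hom_def)
  ultimately show "crdsa (B\<lparr>carrier := f ` carrier A\<rparr>)"
    using \<open>crdsa B\<close> crdsa_reflect by blast
  show "f \<in> crdsa_iso A (B\<lparr>carrier := f ` carrier A\<rparr>)"
    using f by (auto simp: crdsa_iso_def crdsa_mon_def crdsa_hom_def bij_betw_def)
qed

section \<open>The three-element chain and its powers\<close>

lemma crdsa_C3: "crdsa C3"
proof -
  have le: "x \<sqsubseteq>\<^bsub>C3\<^esub> y \<longleftrightarrow> x \<le> y" for x y
    by (auto simp: lat_le_def C3_def min_def)
  show ?thesis
  proof (unfold_locales, goal_cases)
    case 21 show ?case by (simp add: core_def dense_def dually_dense_def C3_def)
  next
    case (13 x y z) show ?case
      by (simp add: C3_def min_max_distrib2)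
  next
    case (16 x y) show ?case
      unfolding le by (cases x; cases y) (simp_all add: C3_def min_def max_def)
  next
    case (17 x y) show ?case
      unfolding le by (cases x; cases y) (simp_all add: C3_def min_def max_def)
  next
    case (18 x) show ?case by (cases x) (simp_all add: C3_def min_def max_def)
  next
    case (19 x) show ?case by (cases x) (simp_all add: C3_def min_def max_def)
  next
    case (20 x y) show ?case
      unfolding le by (cases x; cases y) (simp_all add: C3_def min_def max_def)
  next
    case (15 x) show ?case unfolding le by (cases x) (simp_all add: C3_def)
  qed (simp_all add: le, simp_all add: C3_def ac_simps)
qed

text \<open>Extensionality of \<open>f\<close> is what makes this work: outside \<open>I\<close> it
  agrees with the restricted pointwise meet, so only the coordinates in \<open>I\<close>
  count.\<close>

lemma power_algebra_le_iff:
  assumes "f \<in> I \<rightarrow>\<^sub>E S"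
  shows "f \<sqsubseteq>\<^bsub>power_algebra L I\<^esub> g \<longleftrightarrow> (\<forall>i\<in>I. f i \<sqsubseteq>\<^bsub>L\<^esub> g i)"
proof -
  have "restrict (\<lambda>i. f i \<sqinter>\<^bsub>L\<^esub> g i) I = f \<longleftrightarrow> (\<forall>i\<in>I. f i \<sqinter>\<^bsub>L\<^esub> g i = f i)"
    using assms by (auto simp: fun_eq_iff PiE_def extensional_def restrict_def)
  then show ?thesis by (simp add: lat_le_def power_algebra_def)
qed

text \<open>Equality and order are tested coordinatewise (\<open>eq\<close>, \<open>le\<close>), so
  each axiom splits into its instances in \<open>L\<close>.\<close>

lemma crdsa_power_algebra:
  fixes L :: "'b crdsa_sig" (structure)
  assumes "crdsa L"
  shows "crdsa (power_algebra L I)"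
proof -
  interpret crdsa L by fact
  let ?P = "power_algebra L I"
  note [simp] = meet_closed join_closed pcompl_closed dpcompl_closed zero_closed one_closed
  have core: "core_elt L \<in> carrier L" "pcompl L (core_elt L) = \<zero>" "dpcompl L (core_elt L) = \<one>"
    using core_elt_in_core by (auto simp: core_def dense_def dually_dense_def)
  have mem: "f i \<in> carrier L" if "f \<in> carrier ?P" "i \<in> I" for f i
    using that by (auto simp: power_algebra_def)
  have eq: "f = g \<longleftrightarrow> (\<forall>i\<in>I. f i = g i)" if "f \<in> carrier ?P" "g \<in> carrier ?P" for f g
    using that by (auto simp: power_algebra_def intro: PiE_ext)
  have le: "f \<sqsubseteq>\<^bsub>?P\<^esub> g \<longleftrightarrow> (\<forall>i\<in>I. f i \<sqsubseteq> g i)" if "f \<in> carrier ?P" for f g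
    using that by (intro power_algebra_le_iff) (simp add: power_algebra_def)
  have c: "f \<sqinter>\<^bsub>?P\<^esub> g \<in> carrier ?P" "f \<squnion>\<^bsub>?P\<^esub> g \<in> carrier ?P"
    if "f \<in> carrier ?P" "g \<in> carrier ?P" for f g
    using mem[OF that(1)] mem[OF that(2)] by (simp_all add: power_algebra_def)
  have c1: "pcompl ?P f \<in> carrier ?P" "dpcompl ?P f \<in> carrier ?P" if "f \<in> carrier ?P" for f
    using mem[OF that] by (simp_all add: power_algebra_def)
  have c0: "\<zero>\<^bsub>?P\<^esub> \<in> carrier ?P" "\<one>\<^bsub>?P\<^esub> \<in> carrier ?P" "core_elt ?P \<in> carrier ?P"
    by (simp_all add: power_algebra_def core)
  have v: "(f \<sqinter>\<^bsub>?P\<^esub> g) i = f i \<sqinter> g i" "(f \<squnion>\<^bsub>?P\<^esub> g) i = f i \<squnion> g i" "pcompl ?P f i = pcompl L (f i)"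
    "dpcompl ?P f i = dpcompl L (f i)" "\<zero>\<^bsub>?P\<^esub> i = \<zero>" "\<one>\<^bsub>?P\<^esub> i = \<one>" "core_elt ?P i = core_elt L"
    if "i \<in> I" for f g i
    using that by (simp_all add: power_algebra_def)
  note s = eq le c c1 c0 v mem
  show ?thesis
  proof (unfold_locales, goal_cases)
    case 7 then show ?case by (simp add: s meet_assoc)
  next
    case 8 then show ?case by (simp add: s join_assoc)
  next
    case 9 then show ?case by (simp add: s meet_comm)
  next
    case 10 then show ?case by (simp add: s join_comm)
  next
    case 11 then show ?case by (simp add: s meet_absorb)
  next
    case 12 then show ?case by (simp add: s join_absorb)
  next
    case 13 then show ?case by (simp add: s distrib)
  next
    case 14 then show ?case by (simp add: s zero_le)
  next
    case 15 then show ?case by (simp add: s le_one)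
  next
    case 16 then show ?case by (simp add: s le_pcompl_iff)
  next
    case 17 then show ?case by (simp add: s dpcompl_le_iff)
  next
    case 18 then show ?case by (simp add: s stone)
  next
    case 19 then show ?case by (simp add: s dual_stone)
  next
    case 20 then show ?case by (simp add: s regular)
  next
    case 21 show ?case by (simp add: core_def dense_def dually_dense_def s core)
  qed (simp_all add: c c1 c0)
qed

section \<open>Disjoint pairs as three-valued functions\<close>

lemma alpha_mon: "alpha U \<in> crdsa_mon (TP U) (power_algebra C3 U)"
proof -
  have "inj_on (alpha U) (carrier (TP U))"
  proof (rule inj_onI)
    fix P Q assume P: "P \<in> carrier (TP U)" and Q: "Q \<in> carrier (TP U)" and e: "alpha U P = alpha U Q"
    \<comment> \<open>Both components are read off as preimages. For the second, disjointness
      matters, since \<open>alpha\<close> tests membership in the first component first.\<close>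
    have rec: "fst Z = {i \<in> U. alpha U Z i = One3}" "snd Z = {i \<in> U. alpha U Z i = Zero3}"
      if "Z \<in> carrier (TP U)" for Z
      using that by (auto simp: TP_def alpha_def split: if_splits)
    show "P = Q"
      using rec[OF P] rec[OF Q] e by (simp add: prod_eq_iff)
  qed
  then show ?thesis
    by (auto simp: crdsa_mon_def crdsa_hom_def TP_def power_algebra_def C3_def alpha_def fun_eq_iff
        min_def max_def)
qed

lemma closed_sig_TP: "closed_sig (TP U)"
  by (auto simp: closed_sig_def TP_def)

lemma crdsa_TP: "crdsa (TP U)"
  using closed_sig_TP crdsa_power_algebra[OF crdsa_C3] alpha_mon by (rule crdsa_reflect)

section \<open>Rough sets as nested pairs of definable sets\<close>

text \<open>For an equivalence relation these are exactly the unions of classes.\<close>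

definition definable :: "'a set \<Rightarrow> ('a \<times> 'a) set \<Rightarrow> 'a set \<Rightarrow> bool"
  where "definable U \<theta> D \<longleftrightarrow> D \<subseteq> U \<and> \<theta> `` D \<subseteq> D"

text \<open>Any class containing \<open>x\<close> is the class of \<open>x\<close>, so that class
  alone decides membership; the same argument gives \<open>upper_eq\<close>.\<close>

lemma lower_eq:
  assumes "equiv U \<theta>"
  shows "lower U \<theta> X = {x \<in> U. \<theta> `` {x} \<subseteq> X}"
proof -
  have "x \<in> U \<and> \<theta> `` {x} = \<theta> `` {y}" if "x \<in> \<theta> `` {y}" for x y
    using that equiv_class_eq[OF assms] equiv_type[OF assms] by blast
  then show ?thesis
    using equiv_class_self[OF assms] unfolding lower_def by blast
qed

lemma upper_eq:
  assumes "equiv U \<theta>"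
  shows "upper U \<theta> X = {x \<in> U. \<theta> `` {x} \<inter> X \<noteq> {}}"
proof -
  have "x \<in> U \<and> \<theta> `` {x} = \<theta> `` {y}" if "x \<in> \<theta> `` {y}" for x y
    using that equiv_class_eq[OF assms] equiv_type[OF assms] by blast
  then show ?thesis
    using equiv_class_self[OF assms] unfolding upper_def by blast
qed

text \<open>The disjunction in \<open>big\<close> expresses that classes have more than one element,
  since \<open>card\<close> is 0 on infinite sets.\<close>

lemma rough_sets_eq:
  assumes eq: "equiv U \<theta>" and big: "\<forall>u\<in>U. infinite (\<theta> `` {u}) \<or> card (\<theta> `` {u}) > 1"
  shows "rough_sets U \<theta> = {(A, B). definable U \<theta> A \<and> definable U \<theta> B \<and> A \<subseteq> B}"
proof (intro equalityI subsetI)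
  fix P assume "P \<in> rough_sets U \<theta>"
  then obtain X where P: "P = (lower U \<theta> X, upper U \<theta> X)"
    by (auto simp: rough_sets_def)
  show "P \<in> {(A, B). definable U \<theta> A \<and> definable U \<theta> B \<and> A \<subseteq> B}"
  proof -
    \<comment> \<open>Related points have the same class, so both approximations are saturated; the
      inclusion holds because a class inside \<open>X\<close> is nonempty and hence meets
      \<open>X\<close>.\<close>
    have "y \<in> U \<and> \<theta> `` {y} = \<theta> `` {x}" if "(x, y) \<in> \<theta>" for x y
      using that equiv_class_eq[OF eq] equiv_type[OF eq] by blast
    then show ?thesis
      using equiv_class_self[OF eq]
      unfolding P definable_def lower_eq[OF eq] upper_eq[OF eq] by blast
  qed
next
  fix P assume "P \<in> {(A, B). definable U \<theta> A \<and> definable U \<theta> B \<and> A \<subseteq> B}"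
  then obtain A B where P: "P = (A, B)" and A: "definable U \<theta> A" and B: "definable U \<theta> B"
    and AB: "A \<subseteq> B" by auto
  \<comment> \<open>The choice depends only on the class as a set, so related points get the same
    representative.\<close>
  define r where "r x = (SOME y. y \<in> \<theta> `` {x})" for x
  have r: "r x \<in> \<theta> `` {x}" if "x \<in> U" for x
    unfolding r_def using equiv_class_self[OF eq that] by (rule someI)
  have r_eq: "r x = r y" if "(x, y) \<in> \<theta>" for x y
    using equiv_class_eq[OF eq that] by (simp add: r_def)
  \<comment> \<open>The fixed points of \<open>r\<close> in \<open>B\<close> form a transversal of
    the classes inside \<open>B\<close>.\<close>
  define X where "X = A \<union> {x \<in> B. r x = x}"
  have "X \<subseteq> U" using A B by (auto simp: X_def definable_def)
  moreover have "lower U \<theta> X = A"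
  proof (intro equalityI subsetI)
    fix x assume "x \<in> A" then show "x \<in> lower U \<theta> X"
      using A by (auto simp: lower_eq[OF eq] X_def definable_def)
  next
    fix x assume "x \<in> lower U \<theta> X"
    then have x: "x \<in> U" "\<theta> `` {x} \<subseteq> X" by (auto simp: lower_eq[OF eq])
    show "x \<in> A"
    proof (rule ccontr)
      assume "x \<notin> A"
      \<comment> \<open>A class outside \<open>A\<close> can lie in \<open>X\<close> only through
        fixed points of \<open>r\<close>, all equal to \<open>r x\<close>; it would then be a
        singleton, against \<open>big\<close>.\<close>
      have "y = r x" if "y \<in> \<theta> `` {x}" for y
      proof -
        have "(y, x) \<in> \<theta>" using that eq by (auto simp: equiv_def dest: symD)
        then have "y \<notin> A" using \<open>x \<notin> A\<close> A by (auto simp: definable_def)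
        then show ?thesis using that x(2) r_eq[of x y] by (auto simp: X_def)
      qed
      then have "\<theta> `` {x} = {r x}" using r[OF x(1)] by blast
      with big x(1) show False by force
    qed
  qed
  moreover have "upper U \<theta> X = B"
  proof (intro equalityI subsetI)
    fix x assume "x \<in> B"
    then have "x \<in> U" using B by (auto simp: definable_def)
    \<comment> \<open>The representative \<open>r x\<close> witnesses that the class of
      \<open>x\<close> meets \<open>X\<close>: it stays in \<open>B\<close> by saturation, and
      \<open>r_eq\<close> makes it a fixed point of \<open>r\<close>.\<close>
    have "(x, r x) \<in> \<theta>" using r[OF \<open>x \<in> U\<close>] by simp
    moreover from this have "r x \<in> B" using B \<open>x \<in> B\<close> by (auto simp: definable_def)
    ultimately show "x \<in> upper U \<theta> X"
      using \<open>x \<in> U\<close> r_eq[of x "r x"] by (auto simp: upper_eq[OF eq] X_def)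
  next
    fix x assume "x \<in> upper U \<theta> X"
    then obtain y where "(x, y) \<in> \<theta>" "y \<in> B" using AB by (auto simp: upper_eq[OF eq] X_def)
    moreover from this have "(y, x) \<in> \<theta>" using eq by (auto simp: equiv_def dest: symD)
    ultimately show "x \<in> B" using B by (auto simp: definable_def)
  qed
  ultimately show "P \<in> rough_sets U \<theta>" unfolding P rough_sets_def by blast
qed

text \<open>By symmetry, a pair leading from the complement into \<open>D\<close> would reverse to
  one leaving \<open>D\<close>.\<close>

lemma definable_Diff:
  assumes "equiv U \<theta>" "definable U \<theta> D"
  shows "definable U \<theta> (U - D)"
  using assms equiv_type[OF assms(1)] unfolding definable_def equiv_def by (blast dest: symD)

lemma definable_ops:
  "definable U \<theta> A \<Longrightarrow> definable U \<theta> B \<Longrightarrow> definable U \<theta> (A \<inter> B)"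
  "definable U \<theta> A \<Longrightarrow> definable U \<theta> B \<Longrightarrow> definable U \<theta> (A \<union> B)"
  "definable U \<theta> {}"
  by (auto simp: definable_def)

section \<open>The rough set algebra and its embedding\<close>

context
  fixes U :: "'a set" and \<theta> :: "('a \<times> 'a) set"
  assumes eq: "equiv U \<theta>" and big: "\<forall>u\<in>U. infinite (\<theta> `` {u}) \<or> card (\<theta> `` {u}) > 1"
begin

lemma definable_space: "definable U \<theta> U"
  using definable_Diff[OF eq definable_ops(3)] by simp

text \<open>Density forces the upper part to be \<open>U\<close> and dual density forces the lower
  part to be empty; \<open>rough_sets_eq\<close> guarantees that this pair is a rough set. This
  fixes the value of the description in \<open>with_core_elt\<close>.\<close>

lemma core_rough_dsa: "core (rough_dsa U \<theta>) = {({}, U)}"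
  using definable_space
  by (auto simp: core_def dense_def dually_dense_def rough_dsa_def rough_sets_eq[OF eq big]
      definable_ops, auto simp: definable_def)

lemma rough_algebra_eq:
  "rough_algebra U \<theta> =
    \<lparr>carrier = {(A, B). definable U \<theta> A \<and> definable U \<theta> B \<and> A \<subseteq> B},
     meet = \<lambda>(A, B) (C, D). (A \<inter> C, B \<inter> D),
     join = \<lambda>(A, B) (C, D). (A \<union> C, B \<union> D),
     pcompl = \<lambda>(A, B). (U - B, U - B),
     dpcompl = \<lambda>(A, B). (U - A, U - A),
     lzero = ({}, {}),
     lone = (U, U),
     core_elt = ({}, U)\<rparr>"
  using core_rough_dsa
  by (simp add: rough_algebra_def with_core_elt_def dsa_sig.extend_def crdsa_sig.fields_def)
    (simp add: rough_dsa_def rough_sets_eq[OF eq big])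

lemma closed_sig_rough_algebra: "closed_sig (rough_algebra U \<theta>)"
  using definable_space
  by (auto simp: closed_sig_def rough_algebra_eq definable_ops definable_Diff[OF eq])

text \<open>Complementing the second component exchanges union and intersection there, and turns the
  inclusion of \<open>A\<close> in \<open>B\<close> into disjointness. Injectivity holds because
  \<open>B\<close> lies in \<open>U\<close>.\<close>

lemma phi_mon: "phi U \<in> crdsa_mon (rough_algebra U \<theta>) (TP U)"
  unfolding crdsa_mon_def crdsa_hom_def rough_algebra_eq
  by (auto simp: TP_def phi_def definable_def inj_on_def)

end

theorem mainTheorem5:
  fixes U :: "'a set" and \<theta> :: "('a \<times> 'a) set"
  assumes "approximation_space U \<theta>"
    and "\<forall>u\<in>U. infinite (\<theta> `` {u}) \<or> card (\<theta> `` {u}) > 1"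
  defines "R \<equiv> rough_algebra U \<theta>"
    and "C \<equiv> power_algebra C3 U"
    and "\<psi> \<equiv> alpha_r U \<theta> \<circ> phi U"
  shows "crdsa R \<and> crdsa (TP U) \<and> crdsa C
    \<and> phi U \<in> crdsa_mon R (TP U)
    \<and> alpha U \<in> crdsa_mon (TP U) C
    \<and> \<psi> \<in> crdsa_mon R C
    \<and> crdsa ((TP U)\<lparr>carrier := phi U ` carrier R\<rparr>)
    \<and> phi U \<in> crdsa_iso R ((TP U)\<lparr>carrier := phi U ` carrier R\<rparr>)
    \<and> crdsa (C\<lparr>carrier := \<psi> ` carrier R\<rparr>)
    \<and> \<psi> \<in> crdsa_iso R (C\<lparr>carrier := \<psi> ` carrier R\<rparr>)"
proof -
  have eq: "equiv U \<theta>"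
    using assms(1) by (simp add: approximation_space_def)
  have C: "crdsa C" unfolding C_def by (intro crdsa_power_algebra crdsa_C3)
  have phi: "phi U \<in> crdsa_mon R (TP U)" unfolding R_def using eq assms(2) by (rule phi_mon)
  have R: "crdsa R"
    using closed_sig_rough_algebra[OF eq assms(2)] crdsa_TP phi unfolding R_def by (rule crdsa_reflect)
  have alpha: "alpha U \<in> crdsa_mon (TP U) C" unfolding C_def by (rule alpha_mon)
  \<comment> \<open>The restricted map \<open>alpha_r\<close> is \<open>undefined\<close> off the
    image of \<open>phi U\<close>, so agreement is claimed only on \<open>carrier R\<close>.\<close>
  have psi_eq: "\<psi> x = (alpha U \<circ> phi U) x" if "x \<in> carrier R" for x
    using that by (simp add: \<psi>_def alpha_r_def R_def)
  have comp: "alpha U \<circ> phi U \<in> crdsa_mon R C" using phi alpha by (rule crdsa_mon_comp)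
  \<comment> \<open>The homomorphism laws evaluate \<open>\<psi>\<close> at results of operations,
    which must lie in \<open>carrier R\<close> for \<open>psi_eq\<close> to apply.\<close>
  have "closed_sig R" using R by (rule crdsa_closed_sig)
  with comp have psi: "\<psi> \<in> crdsa_mon R C"
    using psi_eq unfolding closed_sig_def crdsa_mon_def crdsa_hom_def
    by (simp add: Pi_iff cong: inj_on_cong)
  show ?thesis
    using R C phi alpha psi crdsa_TP crdsa_image[OF R crdsa_TP phi] crdsa_image[OF R C psi] by blast
qed

end
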